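(* Let $S\in\mathbb{C}^{n\times n}$ be an upper triangular matrix with diagonal entries $\alpha_1,\dots,\alpha_n$. Then there exists a unitary matrix $U$ preserving the block equivalence relation $\Bumpeq$ such that $$U^*SU=\operatorname{diag}[B_1,\dots,B_k],$$ where, for $l=1,\dots,k$, $B_l$ is an upper triangular $m_l\times m_l$ matrix $$B_l=\begin{pmatrix}\tilde\alpha_1(l)&r_{12}(l)&\cdots&r_{1m_l}(l)\\0&\tilde\alpha_2(l)&\ddots&\vdots\\ \vdots&\ddots&\ddots&r_{(m_l-1)m_l}(l)\\0&\cdots&0&\tilde\alpha_{m_l}(l)\end{pmatrix}$$ and $\tilde\alpha_i(l)\Bumpeq\tilde\alpha_j(l)$ for all $i,j$ and $l$.
   Context: Block equivalence: let $T=(t_{ij})$ be an $n\times n$ upper triangular matrix with diagonal entries $\alpha_i=t_{ii}$. Diagonal entries in different positions are regarded as different objects even if numerically equal, so the relations below are relations on the positions $1,\dots,n$. (a) $\alpha_i\bumpeq\alpha_j$ (directly related) if $i=j$, or $i<j$ and $t_{ij}\ne 0$, or $i>j$ and $t_{ji}\ne 0$. (b) $\alpha_i\Bumpeq\alpha_j$ (block equivalent) if there is a subset $\{\sigma_1,\dots,\sigma_m\}$ of $\{1,\dots,n\}$ with $\alpha_i\bumpeq\alpha_{\sigma_1}\bumpeq\cdots\bumpeq\alpha_{\sigma_m}\bumpeq\alpha_j$. This is an equivalence relation, whose classes are the connected components of the graph on $\{1,\dots,n\}$ with an edge between $i<j$ whenever $t_{ij}\neq0$. "$U$ preserves $\Bumpeq$"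 means: $U^*SU$ is upper triangular and there is a permutation $\sigma$ of $\{1,\dots,n\}$ such that the $i$-th diagonal entry of $U^*SU$ is $\alpha_{\sigma(i)}$ for every $i$, and for all $i,j$ the diagonal entries in positions $i,j$ of $U^*SU$ are block equivalent with respect to $U^*SU$ if and only if the diagonal entries in positions $\sigma(i),\sigma(j)$ of $S$ are block equivalent with respect to $S$. *)

theory Defs
  imports
    Complex_Main
    "HOL-Combinatorics.Permutations"
    "Jordan_Normal_Form.Schur_Decomposition"
begin

text \<open>All relations on diagonal entries are relations on their positions, counted from \<open>0\<close>:
  numerically equal entries in different positions are different objects.\<close>

definition directly_related :: "complex mat \<Rightarrow> nat \<Rightarrow> nat \<Rightarrow> bool" where
  "directly_related T i j \<longleftrightarrow>
     i < dim_row T \<and> j < dim_row T \<and>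
     (i = j \<or> (i < j \<and> T $$ (i, j) \<noteq> 0) \<or> (j < i \<and> T $$ (j, i) \<noteq> 0))"

definition block_equivalent :: "complex mat \<Rightarrow> nat \<Rightarrow> nat \<Rightarrow> bool" where
  "block_equivalent T i j \<longleftrightarrow>
     (\<exists>\<sigma>s. set \<sigma>s \<subseteq> {..<dim_row T} \<and> successively (directly_related T) (i # \<sigma>s @ [j]))"

definition unitary_mat :: "complex mat \<Rightarrow> bool" where
  "unitary_mat U \<longleftrightarrow>
     square_mat U \<and> mat_adjoint U * U = 1\<^sub>m (dim_row U) \<and> U * mat_adjoint U = 1\<^sub>m (dim_row U)"

definition preserves_block_equivalence :: "complex mat \<Rightarrow> complex mat \<Rightarrow> bool" where
  "preserves_block_equivalence S U \<longleftrightarrow>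
     (let n = dim_row S; T = mat_adjoint U * S * U in
        upper_triangular T \<and>
        (\<exists>\<sigma>. \<sigma> permutes {..<n} \<and>
             (\<forall>i<n. T $$ (i, i) = S $$ (\<sigma> i, \<sigma> i)) \<and>
             (\<forall>i<n. \<forall>j<n. block_equivalent T i j \<longleftrightarrow> block_equivalent S (\<sigma> i) (\<sigma> j))))"

text \<open>The position in \<open>diag_block_mat Bs\<close> of the first diagonal entry of the block \<open>Bs ! l\<close>.\<close>

definition block_start :: "complex mat list \<Rightarrow> nat \<Rightarrow> nat" where
  "block_start Bs l = sum_list (map dim_row (take l Bs))"

end

theory Submission
  imports Defs
begin

text \<open>
  A permutation matrix suffices. List the positions component by component, in increasing order
  inside each component, and let \<open>U\<close> be the matrix of this reordering. Then \<open>U\<^sup>* S U\<close> is \<open>S\<close> with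
  rows and columns read in the new order (\<open>permutation_conjugation\<close>). An entry of \<open>S\<close> whose two
  positions lie in different components vanishes, so the reordered matrix is block diagonal with
  one block per component (\<open>reindexed_concat\<close>). It remains upper triangular because an entry
  below the diagonal either joins two components, or has its positions in the same component and
  hence in their original order (\<open>upper_triangular_reindexed\<close>).

  The delicate point is that \<open>\<Bumpeq>\<close> for the reordered matrix must correspond to \<open>\<Bumpeq>\<close> for \<open>S\<close>, although
  direct relatedness refers to the order of the positions. For an upper triangular matrix it
  does not depend on that order: two distinct positions are directly related iff one of the two
  entries joining them is nonzero (\<open>directly_related_upper_triangular\<close>). As both matrices are upper
  triangular, the reordering is an isomorphism between the graphs of direct relatedness, and it
  carries components to components.
\<close>

section \<open>Block equivalence as a transitive closure\<close>

lemma directly_related_upper_triangular: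
  assumes "upper_triangular T"
  shows "directly_related T i j \<longleftrightarrow>
    i < dim_row T \<and> j < dim_row T \<and> (i = j \<or> T $$ (i, j) \<noteq> 0 \<or> T $$ (j, i) \<noteq> 0)"
  unfolding directly_related_def
  using upper_triangularD[OF assms, of j i] upper_triangularD[OF assms, of i j]
  by (cases i j rule: linorder_cases) auto

text \<open>The closure is not reflexive on all natural numbers: like block equivalence, it only relates
  positions inside the matrix. Taking the transitive closure makes the equality hold without
  range conditions.\<close>

lemma block_equivalent_eq_tranclp: "block_equivalent T = (directly_related T)\<^sup>+\<^sup>+"
proof (intro ext iffI)
  fix i j
  have "(directly_related T)\<^sup>+\<^sup>+ i j" if "successively (directly_related T) (i # \<sigma>s @ [j])" for \<sigma>s
    using that
    by (induction \<sigma>s arbitrary: i) (auto intro: tranclp_into_tranclp2)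
  then show "(directly_related T)\<^sup>+\<^sup>+ i j" if "block_equivalent T i j"
    using that unfolding block_equivalent_def by blast
next
  fix i j
  assume "(directly_related T)\<^sup>+\<^sup>+ i j"
  then show "block_equivalent T i j"
  proof (induction rule: converse_tranclp_induct)
    case (base i)
    then show ?case
      unfolding block_equivalent_def by (intro exI[of _ "[]"]) auto
  next
    case (step i k)
    then obtain \<sigma>s where "set \<sigma>s \<subseteq> {..<dim_row T}"
      and "successively (directly_related T) (k # \<sigma>s @ [j])"
      unfolding block_equivalent_def by blast
    with step.hyps(1) show ?case
      unfolding block_equivalent_def
      by (intro exI[of _ "k # \<sigma>s"]) (auto simp: directly_related_def)
  qed
qed

lemma equiv_block_equivalent: "equiv {..<dim_row T} {(i, j). block_equivalent T i j}"
proof (intro equivI)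
  have "(directly_related T)\<inverse>\<inverse> = directly_related T"
    by (intro ext) (auto simp: directly_related_def)
  then have "block_equivalent T i j \<Longrightarrow> block_equivalent T j i" for i j
    unfolding block_equivalent_eq_tranclp by (metis conversepI tranclp_converse)
  then show "sym {(i, j). block_equivalent T i j}"
    by (auto intro: symI)
  have "i < dim_row T \<and> j < dim_row T" if "(directly_related T)\<^sup>+\<^sup>+ i j" for i j
    using that by induction (auto simp: directly_related_def)
  then show "{(i, j). block_equivalent T i j} \<subseteq> {..<dim_row T} \<times> {..<dim_row T}"
    unfolding block_equivalent_eq_tranclp by auto
  show "refl_on {..<dim_row T} {(i, j). block_equivalent T i j}"
    unfolding block_equivalent_eq_tranclp
    by (auto intro!: refl_onI tranclp.r_into_trancl simp: directly_related_def)
  show "trans {(i, j). block_equivalent T i j}"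
    unfolding block_equivalent_eq_tranclp by (auto intro!: transI)
qed

text \<open>A path of directly related positions may pass through any position. Surjectivity of \<open>\<sigma>\<close>
  makes every path between images the image of a path.\<close>

lemma block_equivalent_iso:
  assumes "bij \<sigma>"
    and iso: "\<And>i j. directly_related T i j \<longleftrightarrow> directly_related S (\<sigma> i) (\<sigma> j)"
  shows "block_equivalent T i j \<longleftrightarrow> block_equivalent S (\<sigma> i) (\<sigma> j)"
  unfolding block_equivalent_eq_tranclp
proof
  assume "(directly_related T)\<^sup>+\<^sup>+ i j"
  then show "(directly_related S)\<^sup>+\<^sup>+ (\<sigma> i) (\<sigma> j)"
    by induction (auto simp: iso intro: tranclp.trancl_into_trancl)
next
  define \<tau> where "\<tau> = inv_into UNIV \<sigma>"
  have inv: "\<sigma> (\<tau> b) = b" "\<tau> (\<sigma> i) = i" for b i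
    using \<open>bij \<sigma>\<close> by (simp_all add: \<tau>_def bij_is_surj surj_f_inv_f bij_is_inj)
  assume "(directly_related S)\<^sup>+\<^sup>+ (\<sigma> i) (\<sigma> j)"
  then have "(directly_related T)\<^sup>+\<^sup>+ i (\<tau> (\<sigma> j))"
  proof induction
    case (base b)
    then show ?case by (auto simp: iso inv)
  next
    case (step b c)
    then have "directly_related T (\<tau> b) (\<tau> c)"
      by (simp add: iso inv)
    with step.IH show ?case
      by (rule tranclp.trancl_into_trancl)
  qed
  then show "(directly_related T)\<^sup>+\<^sup>+ i j"
    by (simp add: inv)
qed

section \<open>Reading a matrix along a list of positions\<close>

definition reindexed :: "'a mat \<Rightarrow> nat list \<Rightarrow> 'a mat" where
  "reindexed S xs = mat (length xs) (length xs) (\<lambda>(i, j). S $$ (xs ! i, xs ! j))"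

lemma reindexed_carrier [simp]: "reindexed S xs \<in> carrier_mat (length xs) (length xs)"
  and dim_row_reindexed [simp]: "dim_row (reindexed S xs) = length xs"
  and dim_col_reindexed [simp]: "dim_col (reindexed S xs) = length xs"
  and index_reindexed [simp]:
    "i < length xs \<Longrightarrow> j < length xs \<Longrightarrow> reindexed S xs $$ (i, j) = S $$ (xs ! i, xs ! j)"
  by (simp_all add: reindexed_def)

lemma upper_triangular_reindexed:
  assumes "sorted_wrt (\<lambda>x y. S $$ (y, x) = 0) xs"
  shows "upper_triangular (reindexed S xs)"
  using assms unfolding upper_triangular_def by (auto simp: sorted_wrt_iff_nth_less)

lemma upper_triangular_reindexed_sorted:
  assumes "upper_triangular S" and "sorted_wrt (<) xs" and "set xs \<subseteq> {..<dim_row S}"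
  shows "sorted_wrt (\<lambda>x y. S $$ (y, x) = 0) xs"
  using assms(2) by (rule sorted_wrt_mono_rel[rotated]) (use assms(1,3) in auto)

text \<open>The hypothesis says that entries joining two different lists vanish. It is phrased with
  \<open>sorted_wrt\<close> for the sake of the induction, in which the head list is split off as the first
  diagonal block.\<close>

lemma reindexed_concat:
  assumes "sorted_wrt (\<lambda>xs ys. \<forall>x\<in>set xs. \<forall>y\<in>set ys. S $$ (x, y) = 0 \<and> S $$ (y, x) = 0) xss"
  shows "reindexed S (concat xss) = diag_block_mat (map (reindexed S) xss)"
  using assms
proof (induction xss)
  case Nil
  then show ?case by (simp add: reindexed_def zero_mat_def) (rule eq_matI; simp)
next
  case (Cons xs xss)
  let ?ys = "concat xss"
  have IH: "diag_block_mat (map (reindexed S) xss) = reindexed S ?ys"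
    using Cons by simp
  have zero: "S $$ (xs ! i, ?ys ! j) = 0 \<and> S $$ (?ys ! j, xs ! i) = 0"
    if "i < length xs" "j < length ?ys" for i j
    using nth_mem[OF that(1)] nth_mem[OF that(2)] Cons.prems by auto
  have "reindexed S (xs @ ?ys) = four_block_mat (reindexed S xs)
      (0\<^sub>m (length xs) (length ?ys)) (0\<^sub>m (length ?ys) (length xs)) (reindexed S ?ys)"
  proof (rule eq_matI, goal_cases)
    case (1 i j)
    then have "i < length xs + length ?ys" "j < length xs + length ?ys"
      by (simp_all del: length_concat)
    then show ?case
      by (cases "i < length xs"; cases "j < length xs")
        (simp_all add: nth_append zero del: length_concat)
  qed (simp_all del: length_concat)
  then show ?case
    by (simp add: IH Let_def del: length_concat)
qed

lemma nth_concat_block_start: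
  assumes "l < length xss" and "i < length (xss ! l)"
  shows "concat xss ! (block_start (map (reindexed S) xss) l + i) = xss ! l ! i"
    and "block_start (map (reindexed S) xss) l + i < length (concat xss)"
proof -
  have "concat xss = concat (take l xss) @ xss ! l @ concat (drop (Suc l) xss)"
    by (subst id_take_nth_drop[OF assms(1)]) simp
  moreover have "block_start (map (reindexed S) xss) l = length (concat (take l xss))"
    by (simp add: block_start_def take_map o_def length_concat)
  ultimately show "concat xss ! (block_start (map (reindexed S) xss) l + i) = xss ! l ! i"
    and "block_start (map (reindexed S) xss) l + i < length (concat xss)"
    using assms(2) by (simp_all add: nth_append del: length_concat)
qed

section \<open>Permutation matrices\<close>

definition permutation_mat :: "nat list \<Rightarrow> complex mat" where
  "permutation_mat xs = mat (length xs) (length xs) (\<lambda>(i, j). if i = xs ! j then 1 else 0)"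

lemma permutation_mat_carrier [simp]:
  "permutation_mat xs \<in> carrier_mat (length xs) (length xs)"
  by (simp add: permutation_mat_def)

lemma adjoint_permutation_mat:
  "mat_adjoint (permutation_mat xs) =
    mat (length xs) (length xs) (\<lambda>(i, j). if j = xs ! i then 1 else 0)"
  by (rule eq_matI) (auto simp: mat_adjoint_def permutation_mat_def mat_of_rows_index)

lemma permutation_conjugation:
  assumes "S \<in> carrier_mat (length xs) (length xs)" and "set xs \<subseteq> {..<length xs}"
  shows "mat_adjoint (permutation_mat xs) * S * permutation_mat xs = reindexed S xs"
proof -
  let ?n = "length xs"
  have xs: "xs ! i < ?n" if "i < ?n" for i
    using assms(2) that nth_mem by blast
  \<comment> \<open>The adjoint on the left selects rows, the matrix on the right selects columns.\<close>
  have "mat_adjoint (permutation_mat xs) * S = mat ?n ?n (\<lambda>(i, j). S $$ (xs ! i, j))"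
    using assms(1) xs
    by (intro eq_matI)
      (auto simp: adjoint_permutation_mat scalar_prod_def if_distrib[of "\<lambda>c. c * _"] cong: if_cong)
  moreover have "mat ?n ?n (\<lambda>(i, j). S $$ (xs ! i, j)) * permutation_mat xs = reindexed S xs"
    using xs
    by (intro eq_matI)
      (auto simp: permutation_mat_def scalar_prod_def if_distrib[of "\<lambda>c. _ * c"] cong: if_cong)
  ultimately show ?thesis by simp
qed

text \<open>Conjugating the identity matrix only renames its positions, so it gives the identity again.\<close>

lemma unitary_permutation_mat:
  assumes "distinct xs" and "set xs = {..<length xs}"
  shows "unitary_mat (permutation_mat xs)"
proof -
  let ?n = "length xs" and ?U = "permutation_mat xs"
  have adj: "mat_adjoint ?U \<in> carrier_mat ?n ?n"
    by (simp add: adjoint_permutation_mat)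
  have xs: "xs ! i < ?n" if "i < ?n" for i
    using assms(2) that nth_mem by blast
  have "mat_adjoint ?U * ?U = mat_adjoint ?U * 1\<^sub>m ?n * ?U"
    using adj by simp
  also have "\<dots> = reindexed (1\<^sub>m ?n) xs"
    by (rule permutation_conjugation) (use assms(2) in auto)
  also have "\<dots> = 1\<^sub>m ?n"
    using assms(1) xs by (intro eq_matI) (auto simp: nth_eq_iff_index_eq)
  finally have left: "mat_adjoint ?U * ?U = 1\<^sub>m ?n" .
  have "?U * mat_adjoint ?U = 1\<^sub>m ?n"
    by (rule mat_mult_left_right_inverse[OF adj permutation_mat_carrier left])
  with left show ?thesis
    by (simp add: unitary_mat_def permutation_mat_def)
qed

text \<open>For an enumeration of all positions, upper triangularity of both matrices already forces the
  block equivalences to agree.\<close>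

lemma permutation_mat_preserves_block_equivalence:
  assumes S: "S \<in> carrier_mat (length xs) (length xs)" "upper_triangular S"
    and xs: "distinct xs" "set xs = {..<length xs}"
    and T: "upper_triangular (reindexed S xs)"
  shows "preserves_block_equivalence S (permutation_mat xs)"
    and "\<And>i j. i < length xs \<Longrightarrow> j < length xs \<Longrightarrow>
           block_equivalent (reindexed S xs) i j \<longleftrightarrow> block_equivalent S (xs ! i) (xs ! j)"
proof -
  let ?n = "length xs" and ?T = "reindexed S xs"
  \<comment> \<open>A permutation in the sense of \<open>permutes\<close> must fix everything beyond the positions.\<close>
  define \<sigma> where "\<sigma> i = (if i < ?n then xs ! i else i)" for i
  have "bij_betw \<sigma> {..<?n} {..<?n}"
    by (rule bij_betw_cong[THEN iffD1, OF _ bij_betw_nth[OF xs(1) refl xs(2)[symmetric]]])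
      (simp add: \<sigma>_def)
  then have perm: "\<sigma> permutes {..<?n}"
    by (rule bij_imp_permutes) (simp add: \<sigma>_def)
  have lt: "\<sigma> i < ?n \<longleftrightarrow> i < ?n" for i
    using permutes_in_image[OF perm] by simp
  have entry: "?T $$ (i, j) = S $$ (\<sigma> i, \<sigma> j)" if "i < ?n" "j < ?n" for i j
    using that by (simp add: \<sigma>_def)
  have "directly_related ?T i j \<longleftrightarrow> directly_related S (\<sigma> i) (\<sigma> j)" for i j
    unfolding directly_related_upper_triangular[OF S(2)] directly_related_upper_triangular[OF T]
    using S(1) by (auto simp del: index_reindexed simp: lt entry inj_eq[OF permutes_inj[OF perm]])
  then have iso: "block_equivalent ?T i j \<longleftrightarrow> block_equivalent S (\<sigma> i) (\<sigma> j)" for i j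
    by (rule block_equivalent_iso[OF permutes_bij[OF perm]])
  have conj: "mat_adjoint (permutation_mat xs) * S * permutation_mat xs = ?T"
    using S(1) xs(2) by (intro permutation_conjugation) auto
  show "preserves_block_equivalence S (permutation_mat xs)"
    unfolding preserves_block_equivalence_def Let_def conj
    using S(1) T perm entry iso by auto
  show "block_equivalent ?T i j \<longleftrightarrow> block_equivalent S (xs ! i) (xs ! j)"
    if "i < ?n" "j < ?n" for i j
    using iso[of i j] that by (simp add: \<sigma>_def)
qed

section \<open>Listing the positions component by component\<close>

lemma component_listing:
  fixes T :: "complex mat"
  obtains xss where "distinct (concat xss)" and "set (concat xss) = {..<dim_row T}"
    and "\<And>xs. xs \<in> set xss \<Longrightarrow> xs \<noteq> [] \<and> sorted_wrt (<) xs"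
    and "\<And>xs x y. xs \<in> set xss \<Longrightarrow> x \<in> set xs \<Longrightarrow> y \<in> set xs \<Longrightarrow> block_equivalent T x y"
    and "sorted_wrt (\<lambda>xs ys. \<forall>x\<in>set xs. \<forall>y\<in>set ys. \<not> block_equivalent T x y) xss"
proof -
  let ?r = "{(i, j). block_equivalent T i j}"
  let ?Cs = "{..<dim_row T} // ?r"
  note equiv = equiv_block_equivalent[of T]
  have sub: "?r \<subseteq> {..<dim_row T} \<times> {..<dim_row T}"
    using equiv by (simp add: equiv_def)
  have fin: "finite C" if "C \<in> ?Cs" for C
    using that in_quotient_imp_subset[OF equiv] finite_subset by blast
  have "finite ?Cs"
    by (rule finite_quotient) (use sub in auto)
  then obtain Cs where Cs: "set Cs = ?Cs" "distinct Cs"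
    using finite_distinct_list by blast
  define xss where "xss = map sorted_list_of_set Cs"
  have set_xs: "set (sorted_list_of_set C) = C" if "C \<in> set Cs" for C
    using that Cs fin by simp
  have union: "\<Union> (set Cs) = {..<dim_row T}"
    using Cs(1) Union_quotient[OF equiv] by simp
  show thesis
  proof (rule that[of xss])
    show "set (concat xss) = {..<dim_row T}"
      using union set_xs by (auto simp: xss_def)
    show "distinct (concat xss)"
    proof (rule distinct_concat)
      have "inj_on sorted_list_of_set (set Cs)"
        using set_xs by (metis inj_onI)
      then show "distinct xss"
        using Cs(2) by (simp add: xss_def distinct_map)
      show "distinct xs" if "xs \<in> set xss" for xs
        using that by (auto simp: xss_def)
      show "set xs \<inter> set ys = {}" if "xs \<in> set xss" "ys \<in> set xss" "xs \<noteq> ys" for xs ys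
        using that quotient_disj[OF equiv] set_xs Cs(1) by (force simp: xss_def)
    qed
    show "xs \<noteq> [] \<and> sorted_wrt (<) xs" if "xs \<in> set xss" for xs
    proof -
      from that obtain C where C: "C \<in> ?Cs" "xs = sorted_list_of_set C"
        using Cs(1) by (auto simp: xss_def)
      then have "C \<noteq> {}"
        using in_quotient_imp_non_empty[OF equiv] by blast
      with C fin show ?thesis by simp
    qed
    show "block_equivalent T x y" if "xs \<in> set xss" "x \<in> set xs" "y \<in> set xs" for xs x y
      using that in_quotient_imp_in_rel[OF equiv] set_xs Cs(1) by (fastforce simp: xss_def)
    have diff: "\<not> block_equivalent T x y" if "C \<in> set Cs" "D \<in> set Cs" "C \<noteq> D" "x \<in> C" "y \<in> D"
      for C D x y
    proof
      assume "block_equivalent T x y"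
      then have "y \<in> C"
        using in_quotient_imp_closed[OF equiv, of C x y] that Cs(1) by simp
      then show False
        using quotient_disj[OF equiv, of C D] that Cs(1) by auto
    qed
    have "sorted_wrt (\<noteq>) Cs"
      using Cs(2) by (auto simp: sorted_wrt_iff_nth_less nth_eq_iff_index_eq)
    then have "sorted_wrt (\<lambda>C D. \<forall>x\<in>C. \<forall>y\<in>D. \<not> block_equivalent T x y) Cs"
      by (rule sorted_wrt_mono_rel[rotated]) (use diff in blast)
    then show "sorted_wrt (\<lambda>xs ys. \<forall>x\<in>set xs. \<forall>y\<in>set ys. \<not> block_equivalent T x y) xss"
      unfolding xss_def sorted_wrt_map
      by (rule sorted_wrt_mono_rel[rotated]) (use set_xs in blast)
  qed
qed

lemma sorted_wrt_concat:
  assumes "\<And>xs. xs \<in> set xss \<Longrightarrow> sorted_wrt P xs"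
    and "sorted_wrt (\<lambda>xs ys. \<forall>x\<in>set xs. \<forall>y\<in>set ys. P x y) xss"
  shows "sorted_wrt P (concat xss)"
  using assms by (induction xss) (auto simp: sorted_wrt_append)

section \<open>The block diagonal form\<close>

theorem theorem5:
  fixes S :: "complex mat" and n :: nat
  assumes "S \<in> carrier_mat n n"
    and "upper_triangular S"
  shows "\<exists>U Bs. U \<in> carrier_mat n n \<and> unitary_mat U \<and> preserves_block_equivalence S U \<and>
           mat_adjoint U * S * U = diag_block_mat Bs \<and>
           (\<forall>l<length Bs. \<exists>m>0. Bs ! l \<in> carrier_mat m m \<and> upper_triangular (Bs ! l) \<and>
              (\<forall>i<m. \<forall>j<m. block_equivalent (mat_adjoint U * S * U)
                               (block_start Bs l + i) (block_start Bs l + j)))"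
proof -
  obtain xss where dist: "distinct (concat xss)" and set_n: "set (concat xss) = {..<n}"
    and blocks: "\<And>xs. xs \<in> set xss \<Longrightarrow> xs \<noteq> [] \<and> sorted_wrt (<) xs"
    and same: "\<And>xs x y. xs \<in> set xss \<Longrightarrow> x \<in> set xs \<Longrightarrow> y \<in> set xs \<Longrightarrow> block_equivalent S x y"
    and different: "sorted_wrt (\<lambda>xs ys. \<forall>x\<in>set xs. \<forall>y\<in>set ys. \<not> block_equivalent S x y) xss"
    using component_listing[of S, unfolded carrier_matD(1)[OF assms(1)]] by blast
  define xs Bs where "xs = concat xss" and "Bs = map (reindexed S) xss"
  have len: "length xs = n"
    using distinct_card[OF dist] set_n by (simp add: xs_def del: set_concat length_concat)
  have S: "S \<in> carrier_mat (length xs) (length xs)" and xs: "distinct xs" "set xs = {..<length xs}"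
    using assms(1) dist set_n len by (simp_all add: xs_def)
  have sub: "set ys \<subseteq> {..<n}" if "ys \<in> set xss" for ys
    using that set_n by auto
  have zero: "S $$ (x, y) = 0 \<and> S $$ (y, x) = 0"
    if "x < n" "y < n" "\<not> block_equivalent S x y" for x y
    using that assms(1) directly_related_upper_triangular[OF assms(2), of x y]
    unfolding block_equivalent_eq_tranclp by auto
  have joining: "sorted_wrt (\<lambda>xs ys. \<forall>x\<in>set xs. \<forall>y\<in>set ys. S $$ (x, y) = 0 \<and> S $$ (y, x) = 0) xss"
    using different by (rule sorted_wrt_mono_rel[rotated]) (use zero sub in blast)
  have inside: "sorted_wrt (\<lambda>x y. S $$ (y, x) = 0) ys" if "ys \<in> set xss" for ys
    using upper_triangular_reindexed_sorted[OF assms(2)] blocks[OF that] sub[OF that] assms(1)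
    by auto
  have "upper_triangular (reindexed S xs)"
    unfolding xs_def
    by (intro upper_triangular_reindexed sorted_wrt_concat inside
        sorted_wrt_mono_rel[OF _ joining]) auto
  note preserves = permutation_mat_preserves_block_equivalence[OF S assms(2) xs this]
  have conj: "mat_adjoint (permutation_mat xs) * S * permutation_mat xs = reindexed S xs"
    using S xs(2) by (intro permutation_conjugation) auto
  have "reindexed S xs = diag_block_mat Bs"
    unfolding xs_def Bs_def by (rule reindexed_concat[OF joining])
  moreover have "\<exists>m>0. Bs ! l \<in> carrier_mat m m \<and> upper_triangular (Bs ! l) \<and>
      (\<forall>i<m. \<forall>j<m. block_equivalent (reindexed S xs) (block_start Bs l + i) (block_start Bs l + j))"
    if "l < length Bs" for l
  proof -
    have l: "l < length xss" "xss ! l \<in> set xss"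
      using that by (simp_all add: Bs_def)
    have "block_equivalent (reindexed S xs) (block_start Bs l + i) (block_start Bs l + j)"
      if "i < length (xss ! l)" "j < length (xss ! l)" for i j
    proof -
      note i = nth_concat_block_start[OF l(1) that(1), of S, folded xs_def Bs_def]
        and j = nth_concat_block_start[OF l(1) that(2), of S, folded xs_def Bs_def]
      show ?thesis
        using same[OF l(2)] that by (simp add: preserves(2) i j)
    qed
    moreover have "Bs ! l = reindexed S (xss ! l)"
      using l by (simp add: Bs_def)
    ultimately show ?thesis
      using blocks[OF l(2)] upper_triangular_reindexed[OF inside[OF l(2)]]
      by (intro exI[of _ "length (xss ! l)"]) simp
  qed
  ultimately show ?thesis
    using preserves(1) unitary_permutation_mat[OF xs] permutation_mat_carrier[of xs] len
    unfolding conj[symmetric]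
    by (intro exI[of _ "permutation_mat xs"] exI[of _ Bs]) (simp add: conj)
qed

end
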